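(* The set $\mathbf{BD}$ of all Bratteli diagrams, with morphisms the equivalence classes $[f]$ of premorphisms and with composition $[g][f]=[gf]$, is a category.
   Context: Multiplicity matrices. For a $k_1\times 1$ matrix $V_1$ and a $k_2\times 1$ matrix $V_2$ of strictly positive integers, a multiplicity matrix $E=(a_{ij}):V_1\to V_2$ is a $k_2\times k_1$ matrix of non-negative integers with $EV_1\le V_2$ entrywise. It is an embedding matrix if for each $j$ there is an $i$ with $a_{ij}\neq 0$. Bratteli diagrams. A (non-zero) Bratteli diagram is a pair $B=(V,E)$, $V=(V_n)_{n\ge1}$, $E=(E_n)_{n\ge1}$, where each $V_n$ is a $k_n\times1$ matrix of strictly positive integers for some $k_n\ge1$, and each $E_n$ is an embedding matrix from $V_n$ to $V_{n+1}$. Put $E_{nm}=E_{m-1}\cdots E_{n+1}E_{n}$ for $n<m$ and $E_{nn}=I$. In addition there is the zero Bratteli diagram, a single zero square matrix of size one, denoted by $0$. $\mathbf{BD}$ denotes the set of all Bratteli diagrams. Premorphisms. A premorphism $f:B\to C$ between non-zero diagrams $B=(V,E)$ and $C=(W,S)$ is a pair $((F_n)_{n\ge1},(f_n)_{n\ge1})$, where $f_1\le f_2\le\cdots$ are positive integers with $\sup_n f_n=\infty$, each $F_n$ is a multiplicity matrix from $V_n$ to $W_{f_n}$, and $F_{n+1}E_n=S_{f_nf_{n+1}}F_n$ for all $n$. The composition of premorphisms $f=((F_n),(f_n)):B\to C$ and $g=((G_n),(g_n)):C\to D$ is $gf=((G_{f_n}F_n)_n,(g_{f_n})_n)$. The identity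 premorphism of $B$ is $((I_n)_n,(n)_n)$ with $I_n$ the identity matrix of order $k_n$. For a Bratteli diagram $B$, the zero premorphism from $B$ to $0$ is the ordered pair $(B,0)$ and the zero premorphism from $0$ to $B$ is the ordered pair $(0,B)$; the composition of the zero premorphism with any other premorphism is defined to be zero. Equivalence. Premorphisms $f=((F_n),(f_n))$ and $g=((G_n),(g_n))$ from $B=(V,E)$ to $C=(W,S)$ are equivalent, $f\sim g$, if there are sequences of positive integers $(n_k)_{k\ge1}$, $(m_k)_{k\ge1}$ such that, for all $k\ge1$, $n_k<m_k<n_{k+1}$, $f_{n_k}<g_{m_k}<f_{n_{k+1}}$, $G_{m_k}E_{n_km_k}=S_{f_{n_k}g_{m_k}}F_{n_k}$ and $F_{n_{k+1}}E_{m_kn_{k+1}}=S_{g_{m_k}f_{n_{k+1}}}G_{m_k}$. This extends in the obvious way to the zero premorphism, since the sets of premorphisms from $B$ to $0$ and from $0$ to $B$ each have only one element. The relation $\sim$ is an equivalence relation on the set of premorphisms from $B$ to $C$. Morphisms. A morphism from $B$ to $C$ is an equivalence class $[f]$ of premorphisms $f:B\to C$. The equivalence class of the zero premorphism (which makes sense only when $B=0$ or $C=0$) is called the zero morphism. The composition of morphisms $[f]:B\to C$ and $[g]:C\to D$ is defined as $[gf]:B\to D$, where $gf$ is the composition of premorphisms.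
   Formalization: The composite B → 0 → C of zero premorphisms with B and C both non-zero, which the text calls zero although no zero premorphism B → C is defined, is taken to be the premorphism made of zero matrices; associativity forces its equivalence class. *)

theory Defs
  imports "Jordan_Normal_Form.Matrix" "HOL-Library.Extended_Nat"
begin

text \<open>Sequences are indexed from 0: index \<open>n\<close> here is index \<open>n + 1\<close> in the usual
  presentation, both for the levels of a diagram and for the values \<open>f n\<close> of the index
  sequence of a premorphism.\<close>

definition positive_column :: "nat mat \<Rightarrow> bool" where
  "positive_column V \<longleftrightarrow> 1 \<le> dim_row V \<and> dim_col V = 1 \<and> (\<forall>i<dim_row V. 0 < V $$ (i, 0))"

text \<open>The order on matrices is entrywise.\<close>

definition multiplicity_matrix :: "nat mat \<Rightarrow> nat mat \<Rightarrow> nat mat \<Rightarrow> bool" where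
  "multiplicity_matrix V1 V2 E \<longleftrightarrow> E \<in> carrier_mat (dim_row V2) (dim_row V1) \<and> E * V1 \<le> V2"

definition embedding_matrix :: "nat mat \<Rightarrow> nat mat \<Rightarrow> nat mat \<Rightarrow> bool" where
  "embedding_matrix V1 V2 E \<longleftrightarrow>
     multiplicity_matrix V1 V2 E \<and> (\<forall>j<dim_col E. \<exists>i<dim_row E. E $$ (i, j) \<noteq> 0)"

text \<open>\<open>Zero_Diagram\<close> is the formal symbol for the zero diagram (a single zero matrix of size
  one), which is not a pair of sequences.\<close>

datatype diagram = Zero_Diagram | Diagram "nat \<Rightarrow> nat mat" "nat \<Rightarrow> nat mat"

fun bratteli :: "diagram \<Rightarrow> bool" where
  "bratteli Zero_Diagram \<longleftrightarrow> True"
| "bratteli (Diagram V E) \<longleftrightarrow>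
     (\<forall>n. positive_column (V n)) \<and> (\<forall>n. embedding_matrix (V n) (V (Suc n)) (E n))"

definition BD :: "diagram set" where
  "BD = {B. bratteli B}"

text \<open>\<open>connecting E n m\<close> is the product \<open>E (m - 1) * \<dots> * E (n + 1) * E n\<close> for \<open>n < m\<close>, and the
  identity for \<open>n = m\<close>; its value for \<open>n > m\<close> is irrelevant.\<close>

primrec connecting :: "(nat \<Rightarrow> nat mat) \<Rightarrow> nat \<Rightarrow> nat \<Rightarrow> nat mat" where
  "connecting E n 0 = 1\<^sub>m (dim_col (E n))"
| "connecting E n (Suc m) =
     (if n \<le> m then E m * connecting E n m else 1\<^sub>m (dim_col (E n)))"

text \<open>\<open>Zero_Pre B C\<close> is the ordered pair \<open>(B, C)\<close>, used only when one of the two diagrams is zero.\<close>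

datatype premorphism =
    Pre "nat \<Rightarrow> nat mat" "nat \<Rightarrow> nat"
  | Zero_Pre diagram diagram

fun premorphisms :: "diagram \<Rightarrow> diagram \<Rightarrow> premorphism set" where
  "premorphisms (Diagram V E) (Diagram W S) =
     {Pre F f | F f. mono f \<and> (SUP n. enat (f n)) = \<infinity>
        \<and> (\<forall>n. multiplicity_matrix (V n) (W (f n)) (F n))
        \<and> (\<forall>n. F (Suc n) * E n = connecting S (f n) (f (Suc n)) * F n)}"
| "premorphisms B C = {Zero_Pre B C}"

fun id_pre :: "diagram \<Rightarrow> premorphism" where
  "id_pre (Diagram V E) = Pre (\<lambda>n. 1\<^sub>m (dim_row (V n))) (\<lambda>n. n)"
| "id_pre Zero_Diagram = Zero_Pre Zero_Diagram Zero_Diagram"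

text \<open>The first equation is the value given to a composite \<open>B \<rightarrow> 0 \<rightarrow> C\<close> of zero premorphisms
  with \<open>B\<close> and \<open>C\<close> non-zero. As no formal zero pair from \<open>B\<close> to \<open>C\<close> exists, the composite is
  taken to consist of zero matrices. The index sequence chosen for it does not matter, since any
  two premorphisms made of zero matrices are equivalent.\<close>

fun zero_pre :: "diagram \<Rightarrow> diagram \<Rightarrow> premorphism" where
  "zero_pre (Diagram V E) (Diagram W S) = Pre (\<lambda>n. 0\<^sub>m (dim_row (W n)) (dim_row (V n))) (\<lambda>n. n)"
| "zero_pre B C = Zero_Pre B C"

text \<open>\<open>comp_pre B D g f\<close> is the composite \<open>gf : B \<rightarrow> D\<close>. The outer diagrams are arguments
  because a pair of sequences does not determine them.\<close>

fun comp_pre :: "diagram \<Rightarrow> diagram \<Rightarrow> premorphism \<Rightarrow> premorphism \<Rightarrow> premorphism" where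
  "comp_pre B D (Pre G g) (Pre F f) = Pre (\<lambda>n. G (f n) * F n) (\<lambda>n. g (f n))"
| "comp_pre B D _ _ = zero_pre B D"

fun equivalent :: "diagram \<Rightarrow> diagram \<Rightarrow> premorphism \<Rightarrow> premorphism \<Rightarrow> bool" where
  "equivalent (Diagram V E) (Diagram W S) (Pre F f) (Pre G g) \<longleftrightarrow>
     (\<exists>n m :: nat \<Rightarrow> nat. \<forall>k.
        n k < m k \<and> m k < n (Suc k) \<and>
        f (n k) < g (m k) \<and> g (m k) < f (n (Suc k)) \<and>
        G (m k) * connecting E (n k) (m k) = connecting S (f (n k)) (g (m k)) * F (n k) \<and>
        F (n (Suc k)) * connecting E (m k) (n (Suc k)) =
          connecting S (g (m k)) (f (n (Suc k))) * G (m k))"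
| "equivalent B C f g \<longleftrightarrow> f = g"

definition pre_rel :: "diagram \<Rightarrow> diagram \<Rightarrow> premorphism rel" where
  "pre_rel B C = {(f, g). f \<in> premorphisms B C \<and> g \<in> premorphisms B C \<and> equivalent B C f g}"

definition pre_class :: "diagram \<Rightarrow> diagram \<Rightarrow> premorphism \<Rightarrow> premorphism set" where
  "pre_class B C f = pre_rel B C `` {f}"

definition bd_hom :: "diagram \<Rightarrow> diagram \<Rightarrow> premorphism set set" where
  "bd_hom B C = premorphisms B C // pre_rel B C"

text \<open>The union of the classes of all composites of representatives; it is a single class
  exactly because composition respects equivalence.\<close>

definition comp_mor ::
  "diagram \<Rightarrow> diagram \<Rightarrow> diagram \<Rightarrow> premorphism set \<Rightarrow> premorphism set \<Rightarrow> premorphism set" where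
  "comp_mor B C D Y X = (\<Union>g\<in>Y. \<Union>f\<in>X. pre_class B D (comp_pre B D g f))"

definition id_mor :: "diagram \<Rightarrow> premorphism set" where
  "id_mor B = pre_class B B (id_pre B)"

text \<open>Categories presented by hom-sets: a morphism is always taken together with its source and
  target, so the sets \<open>Hom A B\<close> need not be disjoint. \<open>Comp A B C g f\<close> is the composite of
  \<open>f : A \<rightarrow> B\<close> and \<open>g : B \<rightarrow> C\<close>.\<close>

locale category =
  fixes Ob :: "'o set"
    and Hom :: "'o \<Rightarrow> 'o \<Rightarrow> 'm set"
    and Comp :: "'o \<Rightarrow> 'o \<Rightarrow> 'o \<Rightarrow> 'm \<Rightarrow> 'm \<Rightarrow> 'm"
    and Id :: "'o \<Rightarrow> 'm"
  assumes comp_in_hom: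
      "\<lbrakk>A \<in> Ob; B \<in> Ob; C \<in> Ob; f \<in> Hom A B; g \<in> Hom B C\<rbrakk> \<Longrightarrow> Comp A B C g f \<in> Hom A C"
    and comp_assoc:
      "\<lbrakk>A \<in> Ob; B \<in> Ob; C \<in> Ob; D \<in> Ob; f \<in> Hom A B; g \<in> Hom B C; h \<in> Hom C D\<rbrakk>
        \<Longrightarrow> Comp A C D h (Comp A B C g f) = Comp A B D (Comp B C D h g) f"
    and id_in_hom: "A \<in> Ob \<Longrightarrow> Id A \<in> Hom A A"
    and comp_id_right: "\<lbrakk>A \<in> Ob; B \<in> Ob; f \<in> Hom A B\<rbrakk> \<Longrightarrow> Comp A A B f (Id A) = f"
    and comp_id_left: "\<lbrakk>A \<in> Ob; B \<in> Ob; f \<in> Hom A B\<rbrakk> \<Longrightarrow> Comp A B B (Id B) f = f"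

end

theory Submission
  imports Defs
begin

text \<open>Two premorphisms are equivalent iff for each \<open>n\<close> their \<open>n\<close>-th matrices become equal after
  being pushed forward to a common later level of the codomain. In this form reflexivity, symmetry,
  transitivity and compatibility with composition are immediate; the interleaved sequences
  in the definition of equivalence are recovered by alternately choosing a later index for the
  one and for the other premorphism.\<close>

section \<open>Products of multiplicity matrices and unbounded index sequences\<close>

text \<open>Left multiplication by a matrix of natural numbers is monotone, so
  \<open>G * (F * U)\<close> is bounded by \<open>G * V\<close> and hence by
  \<open>W\<close>.\<close>

lemma multiplicity_matrix_mult:
  fixes F G :: "nat mat"
  assumes "multiplicity_matrix U V F" and "multiplicity_matrix V W G"
    and "dim_col U = 1" "dim_col V = 1"
  shows "multiplicity_matrix U W (G * F)"
proof -
  have F: "F \<in> carrier_mat (dim_row V) (dim_row U)" and FU: "F * U \<le> V"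
    and G: "G \<in> carrier_mat (dim_row W) (dim_row V)" and GV: "G * V \<le> W"
    using assms by (auto simp: multiplicity_matrix_def)
  have U: "U \<in> carrier_mat (dim_row U) 1"
    using assms by auto
  have "G * (F * U) \<le> G * V"
    using F G FU assms(3,4)
    by (auto simp: less_eq_mat_def scalar_prod_def intro!: sum_mono mult_left_mono)
  then have "G * F * U \<le> W"
    using GV assoc_mult_mat[OF G F U] by auto
  then show ?thesis
    using F G by (auto simp: multiplicity_matrix_def)
qed

text \<open>Trades the supremum in the extended naturals for a statement from which later indices
  can be picked directly.\<close>

lemma SUP_enat_eq_infinity_iff:
  "(SUP n. enat (f n)) = \<infinity> \<longleftrightarrow> (\<forall>b. \<exists>n. b < f n)"
proof
  assume S: "(SUP n. enat (f n)) = \<infinity>"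
  show "\<forall>b. \<exists>n. b < f n"
  proof
    fix b
    have "enat b < (SUP n. enat (f n))"
      using S by simp
    then show "\<exists>n. b < f n"
      by (auto simp: less_SUP_iff)
  qed
next
  assume A: "\<forall>b. \<exists>n. b < f n"
  show "(SUP n. enat (f n)) = \<infinity>"
  proof (rule ccontr)
    assume "(SUP n. enat (f n)) \<noteq> \<infinity>"
    then obtain b where b: "(SUP n. enat (f n)) = enat b"
      by auto
    obtain n where "b < f n"
      using A by blast
    moreover have "enat (f n) \<le> enat b"
      unfolding b[symmetric] by (rule SUP_upper) simp
    ultimately show False
      by simp
  qed
qed

lemma mono_unbounded_obtain:
  fixes f :: "nat \<Rightarrow> nat"
  assumes "mono f" "\<forall>b. \<exists>n. b < f n"
  obtains m where "n < m" "b < f m"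
proof -
  obtain k where k: "b < f k"
    using assms(2) by blast
  have "f k \<le> f (max k (Suc n))"
    by (rule monoD[OF assms(1)]) simp
  then show ?thesis
    using k by (intro that[of "max k (Suc n)"]) auto
qed

section \<open>Connecting matrices of a diagram\<close>

lemma bratteli_carrier:
  assumes "bratteli (Diagram V E)"
  shows "E n \<in> carrier_mat (dim_row (V (Suc n))) (dim_row (V n))"
  using assms by (simp add: embedding_matrix_def multiplicity_matrix_def)

lemma bratteli_dim_col:
  assumes "bratteli (Diagram V E)"
  shows "dim_col (V n) = 1"
  using assms by (simp add: positive_column_def)

text \<open>The diagonal value comes from the base equation when \<open>n\<close> is 0 and from the
  \<open>else\<close> branch when \<open>n\<close> is a successor; both give the identity of order
  \<open>dim_col (E n)\<close>, which is the number of rows of \<open>V n\<close>.\<close>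

lemma connecting_self:
  assumes "bratteli (Diagram V E)"
  shows "connecting E n n = 1\<^sub>m (dim_row (V n))"
  using bratteli_carrier[OF assms, of n] by (cases n) auto

lemma connecting_carrier:
  assumes "bratteli (Diagram V E)" "n \<le> m"
  shows "connecting E n m \<in> carrier_mat (dim_row (V m)) (dim_row (V n))"
  using assms(2)
proof (induction m rule: dec_induct)
  case base
  show ?case
    by (simp add: connecting_self[OF assms(1)])
next
  case (step m)
  then show ?case
    using bratteli_carrier[OF assms(1), of m] by simp
qed

lemma connecting_trans:
  assumes B: "bratteli (Diagram V E)" and "n \<le> m" "m \<le> p"
  shows "connecting E m p * connecting E n m = connecting E n p"
  using assms(3)
proof (induction p rule: dec_induct)
  case base
  show ?case
    using connecting_carrier[OF B \<open>n \<le> m\<close>] by (simp add: connecting_self[OF B])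
next
  case (step p)
  then show ?case
    using assoc_mult_mat[OF bratteli_carrier[OF B, of p] connecting_carrier[OF B, of m p]
        connecting_carrier[OF B \<open>n \<le> m\<close>]] \<open>n \<le> m\<close>
    by simp
qed

lemma connecting_trans_mult:
  assumes "bratteli (Diagram V E)" "n \<le> m" "m \<le> p" "X \<in> carrier_mat (dim_row (V n)) c"
  shows "connecting E m p * (connecting E n m * X) = connecting E n p * X"
  using assoc_mult_mat[OF connecting_carrier[OF assms(1,3)] connecting_carrier[OF assms(1,2)] assms(4)]
    connecting_trans[OF assms(1-3)] by simp

section \<open>Premorphisms between non-zero diagrams\<close>

definition is_pre ::
  "(nat \<Rightarrow> nat mat) \<Rightarrow> (nat \<Rightarrow> nat mat) \<Rightarrow> (nat \<Rightarrow> nat mat) \<Rightarrow> (nat \<Rightarrow> nat mat) \<Rightarrow>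
    (nat \<Rightarrow> nat mat) \<Rightarrow> (nat \<Rightarrow> nat) \<Rightarrow> bool" where
  "is_pre V E W S F f \<longleftrightarrow> Pre F f \<in> premorphisms (Diagram V E) (Diagram W S)"

lemma is_pre_iff:
  "is_pre V E W S F f \<longleftrightarrow> mono f \<and> (\<forall>b. \<exists>n. b < f n)
    \<and> (\<forall>n. multiplicity_matrix (V n) (W (f n)) (F n))
    \<and> (\<forall>n. F (Suc n) * E n = connecting S (f n) (f (Suc n)) * F n)"
  by (simp add: is_pre_def SUP_enat_eq_infinity_iff)

lemma is_pre_carrier:
  "is_pre V E W S F f \<Longrightarrow> F n \<in> carrier_mat (dim_row (W (f n))) (dim_row (V n))"
  by (auto simp: is_pre_iff multiplicity_matrix_def)

lemma is_pre_mono: "is_pre V E W S F f \<Longrightarrow> n \<le> m \<Longrightarrow> f n \<le> f m"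
  unfolding is_pre_iff by (blast dest: monoD)

text \<open>The defining squares for consecutive levels are pasted by induction on
  \<open>m\<close>.\<close>

lemma is_pre_connecting:
  assumes B: "bratteli (Diagram V E)" and C: "bratteli (Diagram W S)"
    and F: "is_pre V E W S F f" and "n \<le> m"
  shows "F m * connecting E n m = connecting S (f n) (f m) * F n"
  using \<open>n \<le> m\<close>
proof (induction m rule: dec_induct)
  case base
  show ?case
    using is_pre_carrier[OF F, of n] by (simp add: connecting_self[OF B] connecting_self[OF C])
next
  case (step m)
  have le: "f n \<le> f m" "f m \<le> f (Suc m)"
    using is_pre_mono[OF F] step by auto
  have "F (Suc m) * connecting E n (Suc m) = F (Suc m) * E m * connecting E n m"
    using step assoc_mult_mat[OF is_pre_carrier[OF F] bratteli_carrier[OF B]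
        connecting_carrier[OF B \<open>n \<le> m\<close>]] by simp
  also have "\<dots> = connecting S (f m) (f (Suc m)) * F m * connecting E n m"
    using F by (simp add: is_pre_iff)
  also have "\<dots> = connecting S (f m) (f (Suc m)) * (F m * connecting E n m)"
    by (rule assoc_mult_mat[OF connecting_carrier[OF C le(2)] is_pre_carrier[OF F]
        connecting_carrier[OF B \<open>n \<le> m\<close>]])
  also have "\<dots> = connecting S (f n) (f (Suc m)) * F n"
    using step connecting_trans_mult[OF C le is_pre_carrier[OF F]] by simp
  finally show ?case .
qed

section \<open>Agreement at a common later level\<close>

text \<open>For fixed \<open>n\<close> the first equation is equality in the direct limit, over the
  levels of the codomain, of the matrices out of \<open>V n\<close>. No interleaving is involved, so
  each \<open>n\<close> can be treated separately.\<close>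

fun agree :: "diagram \<Rightarrow> diagram \<Rightarrow> premorphism \<Rightarrow> premorphism \<Rightarrow> bool" where
  "agree (Diagram V E) (Diagram W S) (Pre F f) (Pre G g) \<longleftrightarrow>
     (\<forall>n. \<exists>p. f n \<le> p \<and> g n \<le> p \<and> connecting S (f n) p * F n = connecting S (g n) p * G n)"
| "agree B C f g \<longleftrightarrow> f = g"

lemma agree_refl: "agree B C f f"
  by (cases "(B, C, f, f)" rule: agree.cases) auto

lemma agree_sym: "agree B C f g \<Longrightarrow> agree B C g f"
proof (induction B C f g rule: agree.induct)
  case (1 V E W S F f G g)
  then show ?case
    by (auto simp: conj_ac) metis
qed auto

lemma premorphisms_nonzero_cases:
  assumes "f \<in> premorphisms B C" "B = Diagram V E" "C = Diagram W S"
  obtains F i where "f = Pre F i" "is_pre V E W S F i"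
proof -
  obtain F i where "f = Pre F i"
    using assms by auto
  then show ?thesis
    using assms that[of F i] by (simp add: is_pre_def del: premorphisms.simps)
qed

text \<open>As soon as one diagram is zero there is exactly one premorphism and both relations
  collapse to equality. This lets the proofs below dispose of all such pairs at once.\<close>

lemma diagram_pair_cases:
  obtains V E W S where "B = Diagram V E" "C = Diagram W S"
  | "premorphisms B C = {Zero_Pre B C}" "agree B C = (=)" "equivalent B C = (=)"
    "zero_pre B C = Zero_Pre B C"
  by (cases B; cases C) (auto simp: fun_eq_iff)

lemma agree_trans:
  assumes "C \<in> BD" "f \<in> premorphisms B C" "g \<in> premorphisms B C" "h \<in> premorphisms B C"
    and "agree B C f g" "agree B C g h"
  shows "agree B C f h"
proof (cases B C rule: diagram_pair_cases)
  case (1 V E W S)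
  note [simp] = 1
  have C: "bratteli (Diagram W S)"
    using assms(1) by (simp add: BD_def)
  obtain F i where f [simp]: "f = Pre F i" and F: "is_pre V E W S F i"
    by (rule premorphisms_nonzero_cases[OF assms(2) 1])
  obtain G j where g [simp]: "g = Pre G j" and G: "is_pre V E W S G j"
    by (rule premorphisms_nonzero_cases[OF assms(3) 1])
  obtain H k where h [simp]: "h = Pre H k" and H: "is_pre V E W S H k"
    by (rule premorphisms_nonzero_cases[OF assms(4) 1])
  show ?thesis
  proof (simp, rule allI)
    fix n
    obtain p where p: "i n \<le> p" "j n \<le> p"
      "connecting S (i n) p * F n = connecting S (j n) p * G n"
      using assms(5) by auto
    obtain q where q: "j n \<le> q" "k n \<le> q"
      "connecting S (j n) q * G n = connecting S (k n) q * H n"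
      using assms(6) by auto
    \<comment> \<open>An equation at level \<open>p\<close> persists at every later level, so at the
      maximum both equations hold and can be chained.\<close>
    define r where "r = max p q"
    have r: "p \<le> r" "q \<le> r"
      by (auto simp: r_def)
    have "connecting S (i n) r * F n = connecting S (j n) r * G n"
      using connecting_trans_mult[OF C p(1) r(1) is_pre_carrier[OF F]]
        connecting_trans_mult[OF C p(2) r(1) is_pre_carrier[OF G]] p(3) by simp
    also have "\<dots> = connecting S (k n) r * H n"
      using connecting_trans_mult[OF C q(1) r(2) is_pre_carrier[OF G]]
        connecting_trans_mult[OF C q(2) r(2) is_pre_carrier[OF H]] q(3) by simp
    finally show "\<exists>p\<ge>i n. k n \<le> p \<and> connecting S (i n) p * F n = connecting S (k n) p * H n"
      using p q r by (meson le_trans)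
  qed
next
  case 2
  then show ?thesis
    using assms by auto
qed

section \<open>Agreement coincides with equivalence\<close>

text \<open>One link of the interleaving: since \<open>g\<close> is unbounded, some \<open>m\<close>
  has \<open>g m\<close> beyond the level \<open>p\<close> where the two matrices at
  \<open>n\<close> agree. Naturality of \<open>G\<close> then replaces
  \<open>G m * connecting E n m\<close> by a pushforward of \<open>G n\<close>, hence of
  \<open>F n\<close>.\<close>

lemma agree_step:
  assumes B: "bratteli (Diagram V E)" and C: "bratteli (Diagram W S)"
    and F: "is_pre V E W S F f" and G: "is_pre V E W S G g"
    and A: "agree (Diagram V E) (Diagram W S) (Pre F f) (Pre G g)"
  shows "\<exists>m>n. f n < g m \<and> G m * connecting E n m = connecting S (f n) (g m) * F n"
proof -
  obtain p where p: "f n \<le> p" "g n \<le> p"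
    "connecting S (f n) p * F n = connecting S (g n) p * G n"
    using A by auto
  obtain m where m: "n < m" "p < g m"
    using mono_unbounded_obtain[of g n p] G unfolding is_pre_iff by blast
  have "G m * connecting E n m = connecting S (g n) (g m) * G n"
    using is_pre_connecting[OF B C G] m by simp
  also have "\<dots> = connecting S (f n) (g m) * F n"
    using connecting_trans_mult[OF C p(1) _ is_pre_carrier[OF F], of "g m"]
      connecting_trans_mult[OF C p(2) _ is_pre_carrier[OF G], of "g m"] p(3) m(2) by simp
  finally show ?thesis
    using m p by (intro exI[of _ m]) auto
qed

lemma equivalent_iff_agree:
  assumes "B \<in> BD" "C \<in> BD" "f \<in> premorphisms B C" "g \<in> premorphisms B C"
  shows "equivalent B C f g \<longleftrightarrow> agree B C f g"
proof (cases B C rule: diagram_pair_cases)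
  case (1 V E W S)
  note [simp] = 1
  have B: "bratteli (Diagram V E)" and C: "bratteli (Diagram W S)"
    using assms(1,2) by (simp_all add: BD_def)
  obtain F i where f [simp]: "f = Pre F i" and F: "is_pre V E W S F i"
    by (rule premorphisms_nonzero_cases[OF assms(3) 1])
  obtain G j where g [simp]: "g = Pre G j" and G: "is_pre V E W S G j"
    by (rule premorphisms_nonzero_cases[OF assms(4) 1])
  show ?thesis
  proof
    assume "equivalent B C f g"
    then obtain a b where ab: "\<And>k. a k < b k" "\<And>k. b k < a (Suc k)" "\<And>k. i (a k) < j (b k)"
      "\<And>k. G (b k) * connecting E (a k) (b k) = connecting S (i (a k)) (j (b k)) * F (a k)"
      by auto
    have "strict_mono a"
      using ab(1,2) by (auto simp: strict_mono_Suc_iff intro: less_trans)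
    show "agree B C f g"
    proof (simp, rule allI)
      fix n
      \<comment> \<open>The \<open>n\<close>-th square of the interleaving starts at or after level
        \<open>n\<close>, so composing it with \<open>connecting E n (a n)\<close> brings it back to
        level \<open>n\<close>; the common later level is \<open>j (b n)\<close>.\<close>
      have na: "n \<le> a n"
        using \<open>strict_mono a\<close> by (rule strict_mono_imp_increasing)
      note le = na less_imp_le[OF ab(1)[of n]]
      have ij: "i n \<le> i (a n)" "i (a n) \<le> j (b n)" "j n \<le> j (b n)"
        using is_pre_mono[OF F le(1)] ab(3)[of n] is_pre_mono[OF G, of n "b n"] le by auto
      have "connecting S (j n) (j (b n)) * G n = G (b n) * connecting E n (b n)"
        using is_pre_connecting[OF B C G, of n "b n"] le by simp
      also have "\<dots> = G (b n) * connecting E (a n) (b n) * connecting E n (a n)"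
        using assoc_mult_mat[OF is_pre_carrier[OF G] connecting_carrier[OF B le(2)]
            connecting_carrier[OF B le(1)]] connecting_trans[OF B le] by simp
      also have "\<dots> = connecting S (i (a n)) (j (b n)) * (F (a n) * connecting E n (a n))"
        unfolding ab(4)
        by (rule assoc_mult_mat[OF connecting_carrier[OF C ij(2)] is_pre_carrier[OF F]
              connecting_carrier[OF B le(1)]])
      also have "\<dots> = connecting S (i n) (j (b n)) * F n"
        unfolding is_pre_connecting[OF B C F le(1)]
        by (rule connecting_trans_mult[OF C ij(1,2) is_pre_carrier[OF F]])
      finally show "\<exists>p\<ge>i n. j n \<le> p \<and> connecting S (i n) p * F n = connecting S (j n) p * G n"
        using ij by (intro exI[of _ "j (b n)"]) auto
    qed
  next
    assume A: "agree B C f g"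
    obtain a where a: "\<And>n. n < a n \<and> i n < j (a n) \<and>
        G (a n) * connecting E n (a n) = connecting S (i n) (j (a n)) * F n"
      using agree_step[OF B C F G] A by simp metis
    obtain b where b: "\<And>n. n < b n \<and> j n < i (b n) \<and>
        F (b n) * connecting E n (b n) = connecting S (j n) (i (b n)) * G n"
      using agree_step[OF B C G F] agree_sym[OF A] by simp metis
    \<comment> \<open>Here \<open>a\<close> passes from an index of \<open>f\<close> to one of
      \<open>g\<close>, and \<open>b\<close> passes back. Iterating \<open>b\<close> after
      \<open>a\<close> from 0 gives the indices \<open>c k\<close> for \<open>f\<close>, with the
      indices \<open>a (c k)\<close> for \<open>g\<close> between them.\<close>
    define c where "c = rec_nat (0::nat) (\<lambda>_ x. b (a x))"
    have c: "c (Suc k) = b (a (c k))" for k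
      by (simp add: c_def)
    show "equivalent B C f g"
      unfolding 1 f g equivalent.simps
      by (rule exI[of _ c], rule exI[of _ "\<lambda>k. a (c k)"]) (use a b in \<open>simp add: c\<close>)
  qed
next
  case 2
  then show ?thesis
    by simp
qed

lemma pre_rel_iff:
  assumes "B \<in> BD" "C \<in> BD"
  shows "(f, g) \<in> pre_rel B C \<longleftrightarrow> f \<in> premorphisms B C \<and> g \<in> premorphisms B C \<and> agree B C f g"
  using equivalent_iff_agree[OF assms] by (auto simp: pre_rel_def)

text \<open>All three properties are transferred from \<open>agree\<close>, so that transitivity
  never has to merge two interleavings with different indices.\<close>

lemma equiv_pre_rel:
  assumes "B \<in> BD" "C \<in> BD"
  shows "equiv (premorphisms B C) (pre_rel B C)"
proof (rule equivI)
  show "pre_rel B C \<subseteq> premorphisms B C \<times> premorphisms B C"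
    by (auto simp: pre_rel_def)
  show "refl_on (premorphisms B C) (pre_rel B C)"
    by (rule refl_onI) (auto simp: pre_rel_iff[OF assms] agree_refl)
  show "sym (pre_rel B C)"
    by (rule symI) (auto simp: pre_rel_iff[OF assms] agree_sym)
  show "trans (pre_rel B C)"
    by (rule transI) (auto simp: pre_rel_iff[OF assms] intro: agree_trans[OF assms(2)])
qed

section \<open>Composite, zero and identity premorphisms\<close>

text \<open>The square of \<open>F\<close> at \<open>n\<close> is pasted to that of \<open>G\<close>
  between the levels \<open>f n\<close> and \<open>f (Suc n)\<close>. These need not be consecutive,
  which is why the square of \<open>G\<close> comes from \<open>is_pre_connecting\<close>.\<close>

lemma is_pre_comp:
  assumes B: "bratteli (Diagram V E)" and C: "bratteli (Diagram W S)"
    and D: "bratteli (Diagram X T)"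
    and F: "is_pre V E W S F f" and G: "is_pre W S X T G g"
  shows "is_pre V E X T (\<lambda>n. G (f n) * F n) (\<lambda>n. g (f n))"
proof -
  have "G (f (Suc n)) * F (Suc n) * E n = connecting T (g (f n)) (g (f (Suc n))) * (G (f n) * F n)"
    for n
  proof -
    have le: "f n \<le> f (Suc n)"
      using is_pre_mono[OF F] by simp
    have "G (f (Suc n)) * F (Suc n) * E n = G (f (Suc n)) * (connecting S (f n) (f (Suc n)) * F n)"
      using assoc_mult_mat[OF is_pre_carrier[OF G] is_pre_carrier[OF F] bratteli_carrier[OF B]] F
      by (simp add: is_pre_iff)
    also have "\<dots> = connecting T (g (f n)) (g (f (Suc n))) * G (f n) * F n"
      using assoc_mult_mat[OF is_pre_carrier[OF G] connecting_carrier[OF C le] is_pre_carrier[OF F]]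
        is_pre_connecting[OF C D G le] by simp
    finally show ?thesis
      using assoc_mult_mat[OF connecting_carrier[OF D is_pre_mono[OF G le]] is_pre_carrier[OF G]
          is_pre_carrier[OF F]] by simp
  qed
  moreover have "\<exists>n. b < g (f n)" for b
  proof -
    obtain m where "b < g m"
      using G unfolding is_pre_iff by blast
    moreover obtain n where "m < f n"
      using F unfolding is_pre_iff by blast
    ultimately show ?thesis
      using is_pre_mono[OF G, of m "f n"] by (intro exI[of _ n]) simp
  qed
  moreover have "mono (\<lambda>n. g (f n))"
    using is_pre_mono[OF F] is_pre_mono[OF G] by (simp add: monoI)
  moreover have "multiplicity_matrix (V n) (X (g (f n))) (G (f n) * F n)" for n
    using F G bratteli_dim_col[OF B] bratteli_dim_col[OF C]
    by (intro multiplicity_matrix_mult[of _ "W (f n)"]) (auto simp: is_pre_iff)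
  ultimately show ?thesis
    by (simp add: is_pre_iff)
qed

lemma zero_pre_in:
  assumes "B \<in> BD" "C \<in> BD"
  shows "zero_pre B C \<in> premorphisms B C"
proof (cases B C rule: diagram_pair_cases)
  case (1 V E W S)
  then have B: "bratteli (Diagram V E)" and C: "bratteli (Diagram W S)"
    using assms by (simp_all add: BD_def)
  have "is_pre V E W S (\<lambda>n. 0\<^sub>m (dim_row (W n)) (dim_row (V n))) (\<lambda>n. n)"
    using left_mult_zero_mat[OF bratteli_carrier[OF B]] bratteli_dim_col[OF B]
      bratteli_dim_col[OF C] right_mult_zero_mat[OF connecting_carrier[OF C]]
    by (auto simp: is_pre_iff mono_def multiplicity_matrix_def less_eq_mat_def
        simp del: connecting.simps)
  then show ?thesis
    using 1 by (simp add: is_pre_def)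
next
  case 2
  then show ?thesis
    by simp
qed

lemma id_pre_in:
  assumes "B \<in> BD"
  shows "id_pre B \<in> premorphisms B B"
proof (cases B)
  case (Diagram V E)
  then have B: "bratteli (Diagram V E)"
    using assms by (simp add: BD_def)
  have "is_pre V E V E (\<lambda>n. 1\<^sub>m (dim_row (V n))) (\<lambda>n. n)"
    using left_mult_one_mat[OF bratteli_carrier[OF B]] right_mult_one_mat[OF bratteli_carrier[OF B]]
      bratteli_carrier[OF B]
    by (auto simp: is_pre_iff mono_def multiplicity_matrix_def connecting_self[OF B])
  then show ?thesis
    using Diagram by (simp add: is_pre_def)
qed simp

lemma comp_pre_in:
  assumes "B \<in> BD" "C \<in> BD" "D \<in> BD" "f \<in> premorphisms B C" "g \<in> premorphisms C D"
  shows "comp_pre B D g f \<in> premorphisms B D"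
proof (cases "\<exists>F i G j. f = Pre F i \<and> g = Pre G j")
  case True
  then obtain F i G j where fg: "f = Pre F i" "g = Pre G j"
    by blast
  then obtain V E W S X T where BCD: "B = Diagram V E" "C = Diagram W S" "D = Diagram X T"
    using assms(4,5) by (cases B; cases C; cases D) auto
  have "is_pre V E X T (\<lambda>n. G (i n) * F n) (\<lambda>n. j (i n))"
    using assms unfolding fg BCD BD_def mem_Collect_eq is_pre_def[symmetric] by (rule is_pre_comp)
  then show ?thesis
    by (simp add: fg BCD is_pre_def)
next
  case False
  \<comment> \<open>A formal zero pair as either factor sends \<open>comp_pre\<close> to its second
    equation, even when \<open>B\<close> and \<open>D\<close> are non-zero.\<close>
  then have "comp_pre B D g f = zero_pre B D"
    by (cases f; cases g) auto
  then show ?thesis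
    using zero_pre_in assms by simp
qed

section \<open>Composition up to agreement\<close>

text \<open>Pushing forward a zero matrix gives a zero matrix, so the index sequences do not matter.
  This absorbs the arbitrary choice of index sequence in \<open>zero_pre\<close>.\<close>

lemma agree_zero:
  assumes "bratteli (Diagram W S)"
    and "\<And>n. F n = 0\<^sub>m (dim_row (W (f n))) (dim_row (V n))"
    and "\<And>n. G n = 0\<^sub>m (dim_row (W (g n))) (dim_row (V n))"
  shows "agree (Diagram V E) (Diagram W S) (Pre F f) (Pre G g)"
proof (simp, rule allI)
  fix n
  show "\<exists>p\<ge>f n. g n \<le> p \<and> connecting S (f n) p * F n = connecting S (g n) p * G n"
    using connecting_carrier[OF assms(1), of "f n" "max (f n) (g n)"]
      connecting_carrier[OF assms(1), of "g n" "max (f n) (g n)"]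
    by (intro exI[of _ "max (f n) (g n)"]) (simp add: assms(2,3))
qed

text \<open>The factors are changed one at a time, first \<open>f\<close> to \<open>f'\<close> with
  \<open>g\<close> fixed and then \<open>g\<close> to \<open>g'\<close> with \<open>f'\<close>
  fixed; transitivity joins the two.\<close>

lemma agree_comp:
  assumes "B \<in> BD" "C \<in> BD" "D \<in> BD"
    and "f \<in> premorphisms B C" "f' \<in> premorphisms B C" "agree B C f f'"
    and "g \<in> premorphisms C D" "g' \<in> premorphisms C D" "agree C D g g'"
  shows "agree B D (comp_pre B D g f) (comp_pre B D g' f')"
proof (cases "B = Zero_Diagram \<or> C = Zero_Diagram \<or> D = Zero_Diagram")
  case True
  \<comment> \<open>One of the two positions holds a formal zero pair common to both composites,
    which makes each of them \<open>zero_pre B D\<close>.\<close>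
  then have "f = f' \<and> f = Zero_Pre B C \<or> g = g' \<and> g = Zero_Pre C D"
    using assms by (cases B; cases C; cases D) auto
  then have "comp_pre B D g f = comp_pre B D g' f'"
    by (cases g; cases g') auto
  then show ?thesis
    by (simp add: agree_refl)
next
  case False
  then obtain V E W S X T where BCD [simp]: "B = Diagram V E" "C = Diagram W S" "D = Diagram X T"
    by (cases B; cases C; cases D) auto
  have B: "bratteli (Diagram V E)" and C: "bratteli (Diagram W S)" and D: "bratteli (Diagram X T)"
    using assms(1-3) by (simp_all add: BD_def)
  obtain F i where f [simp]: "f = Pre F i" and F: "is_pre V E W S F i"
    by (rule premorphisms_nonzero_cases[OF assms(4) BCD(1,2)])
  obtain F' i' where f' [simp]: "f' = Pre F' i'" and F': "is_pre V E W S F' i'"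
    by (rule premorphisms_nonzero_cases[OF assms(5) BCD(1,2)])
  obtain G j where g [simp]: "g = Pre G j" and G: "is_pre W S X T G j"
    by (rule premorphisms_nonzero_cases[OF assms(7) BCD(2,3)])
  obtain G' j' where g' [simp]: "g' = Pre G' j'" and G': "is_pre W S X T G' j'"
    by (rule premorphisms_nonzero_cases[OF assms(8) BCD(2,3)])
  \<comment> \<open>By naturality of \<open>G\<close>, pushing the composite forward in
    \<open>D\<close> to level \<open>j p\<close> amounts to pushing \<open>H n\<close> forward in
    \<open>C\<close> to level \<open>p\<close> and then applying \<open>G p\<close>. So agreement at
    \<open>p\<close> yields agreement at \<open>j p\<close>.\<close>
  have push: "connecting T (j (h n)) (j p) * (G (h n) * H n) = G p * (connecting S (h n) p * H n)"
    if H: "is_pre V E W S H h" and p: "h n \<le> p" for H h n p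
    using assoc_mult_mat[OF is_pre_carrier[OF G] connecting_carrier[OF C p] is_pre_carrier[OF H]]
      assoc_mult_mat[OF connecting_carrier[OF D is_pre_mono[OF G p]] is_pre_carrier[OF G]
        is_pre_carrier[OF H]] is_pre_connecting[OF C D G p] by simp
  have "agree B D (comp_pre B D g f) (comp_pre B D g f')"
  proof (simp, rule allI)
    fix n
    obtain p where p: "i n \<le> p" "i' n \<le> p"
      "connecting S (i n) p * F n = connecting S (i' n) p * F' n"
      using assms(6) by auto
    show "\<exists>p\<ge>j (i n). j (i' n) \<le> p \<and> connecting T (j (i n)) p * (G (i n) * F n) =
        connecting T (j (i' n)) p * (G (i' n) * F' n)"
      using push[OF F p(1)] push[OF F' p(2)] p is_pre_mono[OF G]
      by (intro exI[of _ "j p"]) simp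
  qed
  moreover have "agree B D (comp_pre B D g f') (comp_pre B D g' f')"
  proof (simp, rule allI)
    fix n
    \<comment> \<open>Agreement of \<open>g\<close> and \<open>g'\<close> is taken at level
      \<open>i' n\<close> of \<open>C\<close>, where \<open>F' n\<close> lands, and then multiplied
      by \<open>F' n\<close> on the right.\<close>
    obtain p where p: "j (i' n) \<le> p" "j' (i' n) \<le> p"
      "connecting T (j (i' n)) p * G (i' n) = connecting T (j' (i' n)) p * G' (i' n)"
      using assms(9) by auto
    show "\<exists>p\<ge>j (i' n). j' (i' n) \<le> p \<and> connecting T (j (i' n)) p * (G (i' n) * F' n) =
        connecting T (j' (i' n)) p * (G' (i' n) * F' n)"
      using assoc_mult_mat[OF connecting_carrier[OF D p(1)] is_pre_carrier[OF G] is_pre_carrier[OF F']]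
        assoc_mult_mat[OF connecting_carrier[OF D p(2)] is_pre_carrier[OF G'] is_pre_carrier[OF F']] p
      by (intro exI[of _ p]) simp
  qed
  ultimately show ?thesis
    using agree_trans comp_pre_in assms by metis
qed

text \<open>Only agreement is claimed: if exactly one of \<open>B\<close> and \<open>C\<close> is
  zero while \<open>A\<close> and \<open>D\<close> are not, the two bracketings consist of zero
  matrices but may have different index sequences. If all four diagrams are non-zero, this is
  associativity of the matrix product.\<close>

lemma comp_pre_assoc:
  assumes "A \<in> BD" "B \<in> BD" "C \<in> BD" "D \<in> BD"
    and "f \<in> premorphisms A B" "g \<in> premorphisms B C" "h \<in> premorphisms C D"
  shows "agree A D (comp_pre A D h (comp_pre A C g f)) (comp_pre A D (comp_pre B D h g) f)"
proof (cases A D rule: diagram_pair_cases)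
  case (1 V E X T)
  note [simp] = 1
  have D: "bratteli (Diagram X T)"
    using assms by (simp add: BD_def)
  show ?thesis
  proof (cases B)
    case B [simp]: Zero_Diagram
    show ?thesis
    proof (cases C)
      case [simp]: Zero_Diagram
      show ?thesis
        using assms(5-7) by (simp add: agree_refl del: agree.simps)
    next
      case C [simp]: (Diagram W S)
      obtain H k where h [simp]: "h = Pre H k" and H: "is_pre W S X T H k"
        by (rule premorphisms_nonzero_cases[OF assms(7) C 1(2)])
      have "f = Zero_Pre A B" "g = Zero_Pre B C"
        using assms(5,6) by simp_all
      \<comment> \<open>The left bracketing composes \<open>h\<close> with
        \<open>zero_pre A C\<close> and has index sequence \<open>k\<close>; the right one is
        \<open>zero_pre A D\<close>, with the identity sequence.\<close>
      moreover have "H n * 0\<^sub>m (dim_row (W n)) (dim_row (V n)) = 0\<^sub>m (dim_row (X (k n))) (dim_row (V n))"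
        for n
        using is_pre_carrier[OF H, of n] by simp
      ultimately show ?thesis
        by (simp add: agree_zero[OF D] del: agree.simps)
    qed
  next
    case B [simp]: (Diagram W S)
    obtain F i where f [simp]: "f = Pre F i" and F: "is_pre V E W S F i"
      by (rule premorphisms_nonzero_cases[OF assms(5) 1(1) B])
    show ?thesis
    proof (cases C)
      case [simp]: Zero_Diagram
      have "g = Zero_Pre B C" "h = Zero_Pre C D"
        using assms(6,7) by simp_all
      \<comment> \<open>Now the left bracketing is \<open>zero_pre A D\<close>, and the right one
        composes \<open>zero_pre B D\<close> with \<open>f\<close>, which gives it the index
        sequence \<open>i\<close>.\<close>
      moreover have "0\<^sub>m (dim_row (X (i n))) (dim_row (W (i n))) * F n =
          0\<^sub>m (dim_row (X (i n))) (dim_row (V n))" for n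
        using is_pre_carrier[OF F, of n] by simp
      ultimately show ?thesis
        by (simp add: agree_zero[OF D] del: agree.simps)
    next
      case C [simp]: (Diagram U R)
      obtain G j where g [simp]: "g = Pre G j" and G: "is_pre W S U R G j"
        by (rule premorphisms_nonzero_cases[OF assms(6) B C])
      obtain H k where h [simp]: "h = Pre H k" and H: "is_pre U R X T H k"
        by (rule premorphisms_nonzero_cases[OF assms(7) C 1(2)])
      have "H (j (i n)) * (G (i n) * F n) = H (j (i n)) * G (i n) * F n" for n
        by (rule assoc_mult_mat[symmetric, OF is_pre_carrier[OF H] is_pre_carrier[OF G]
              is_pre_carrier[OF F]])
      then show ?thesis
        by (simp add: agree_refl del: agree.simps)
    qed
  qed
next
  case 2
  then show ?thesis
    using comp_pre_in[OF assms(1,3,4) comp_pre_in[OF assms(1,2,3,5,6)] assms(7)]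
      comp_pre_in[OF assms(1,2,4,5) comp_pre_in[OF assms(2,3,4,6,7)]] by simp
qed

lemma comp_pre_id_right:
  assumes "A \<in> BD" "B \<in> BD" "f \<in> premorphisms A B"
  shows "comp_pre A B f (id_pre A) = f"
proof (cases A B rule: diagram_pair_cases)
  case (1 V E W S)
  then obtain F i where f: "f = Pre F i" and F: "is_pre V E W S F i"
    using premorphisms_nonzero_cases[OF assms(3)] by blast
  then show ?thesis
    by (simp add: 1 f right_mult_one_mat[OF is_pre_carrier[OF F]])
next
  case 2
  \<comment> \<open>Both sides lie in a set with a single element.\<close>
  then show ?thesis
    using comp_pre_in[OF assms(1,1,2) id_pre_in[OF assms(1)] assms(3)] assms(3) by simp
qed

lemma comp_pre_id_left:
  assumes "A \<in> BD" "B \<in> BD" "f \<in> premorphisms A B"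
  shows "comp_pre A B (id_pre B) f = f"
proof (cases A B rule: diagram_pair_cases)
  case (1 V E W S)
  then obtain F i where f: "f = Pre F i" and F: "is_pre V E W S F i"
    using premorphisms_nonzero_cases[OF assms(3)] by blast
  then show ?thesis
    by (simp add: 1 f left_mult_one_mat[OF is_pre_carrier[OF F]])
next
  case 2
  then show ?thesis
    using comp_pre_in[OF assms(1,2,2,3) id_pre_in[OF assms(2)]] assms(3) by simp
qed

section \<open>Passage to equivalence classes and the category axioms\<close>

lemma pre_class_eq:
  assumes "B \<in> BD" "C \<in> BD" "f \<in> premorphisms B C" "g \<in> premorphisms B C" "agree B C f g"
  shows "pre_class B C f = pre_class B C g"
  unfolding pre_class_def
  using equiv_class_eq[OF equiv_pre_rel[OF assms(1,2)]] pre_rel_iff[OF assms(1,2)] assms by blast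

lemma mem_pre_class:
  assumes "B \<in> BD" "C \<in> BD" "f \<in> premorphisms B C"
  shows "g \<in> pre_class B C f \<longleftrightarrow> g \<in> premorphisms B C \<and> agree B C f g"
  using pre_rel_iff[OF assms(1,2)] assms(3) by (auto simp: pre_class_def)

text \<open>By \<open>agree_comp\<close> every term of the union defining \<open>comp_mor\<close> is
  the same class, and the union is non-empty because each class contains its representative.\<close>

lemma comp_mor_pre_class:
  assumes "B \<in> BD" "C \<in> BD" "D \<in> BD" "f \<in> premorphisms B C" "g \<in> premorphisms C D"
  shows "comp_mor B C D (pre_class C D g) (pre_class B C f) = pre_class B D (comp_pre B D g f)"
proof -
  have "pre_class B D (comp_pre B D g' f') = pre_class B D (comp_pre B D g f)"
    if "g' \<in> pre_class C D g" "f' \<in> pre_class B C f" for f' g'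
  proof -
    have *: "f' \<in> premorphisms B C" "agree B C f f'" "g' \<in> premorphisms C D" "agree C D g g'"
      using that assms by (simp_all add: mem_pre_class)
    have "agree B D (comp_pre B D g f) (comp_pre B D g' f')"
      by (rule agree_comp[OF assms(1-4) *(1,2) assms(5) *(3,4)])
    moreover have "comp_pre B D g f \<in> premorphisms B D" "comp_pre B D g' f' \<in> premorphisms B D"
      using assms * comp_pre_in by blast+
    ultimately show ?thesis
      using pre_class_eq assms(1,3) by metis
  qed
  moreover have "f \<in> pre_class B C f" "g \<in> pre_class C D g"
    using assms by (auto simp: mem_pre_class agree_refl)
  ultimately show ?thesis
    unfolding comp_mor_def by blast
qed

lemma pre_class_in_hom:
  "f \<in> premorphisms B C \<Longrightarrow> pre_class B C f \<in> bd_hom B C"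
  unfolding bd_hom_def pre_class_def by (rule quotientI)

lemma bd_hom_cases:
  assumes "X \<in> bd_hom B C"
  obtains f where "f \<in> premorphisms B C" "X = pre_class B C f"
  using assms unfolding bd_hom_def pre_class_def by (rule quotientE)

text \<open>After choosing representatives, each axiom reduces to a fact about premorphisms:
  closure, agreement for associativity, and equality for the identity laws.\<close>

lemma category_BD: "category BD bd_hom comp_mor id_mor"
proof
  fix A B C X Y
  assume "A \<in> BD" "B \<in> BD" "C \<in> BD" and X: "X \<in> bd_hom A B" and Y: "Y \<in> bd_hom B C"
  moreover obtain f where "f \<in> premorphisms A B" "X = pre_class A B f"
    by (rule bd_hom_cases[OF X])
  moreover obtain g where "g \<in> premorphisms B C" "Y = pre_class B C g"
    by (rule bd_hom_cases[OF Y])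
  ultimately show "comp_mor A B C Y X \<in> bd_hom A C"
    using comp_pre_in[of A B C f g] by (simp add: comp_mor_pre_class pre_class_in_hom)
next
  fix A B C D X Y Z
  assume *: "A \<in> BD" "B \<in> BD" "C \<in> BD" "D \<in> BD"
    and X: "X \<in> bd_hom A B" and Y: "Y \<in> bd_hom B C" and Z: "Z \<in> bd_hom C D"
  obtain f where f: "f \<in> premorphisms A B" and [simp]: "X = pre_class A B f"
    by (rule bd_hom_cases[OF X])
  obtain g where g: "g \<in> premorphisms B C" and [simp]: "Y = pre_class B C g"
    by (rule bd_hom_cases[OF Y])
  obtain h where h: "h \<in> premorphisms C D" and [simp]: "Z = pre_class C D h"
    by (rule bd_hom_cases[OF Z])
  note fgh = f g h
  have gf: "comp_pre A C g f \<in> premorphisms A C" and hg: "comp_pre B D h g \<in> premorphisms B D"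
    using * fgh comp_pre_in by blast+
  have "pre_class A D (comp_pre A D h (comp_pre A C g f)) =
      pre_class A D (comp_pre A D (comp_pre B D h g) f)"
    by (rule pre_class_eq[OF *(1,4) comp_pre_in[OF *(1,3,4) gf fgh(3)]
          comp_pre_in[OF *(1,2,4) fgh(1) hg] comp_pre_assoc[OF * fgh]])
  then show "comp_mor A C D Z (comp_mor A B C Y X) = comp_mor A B D (comp_mor B C D Z Y) X"
    using * fgh gf hg by (simp add: comp_mor_pre_class)
next
  fix A
  assume "A \<in> BD"
  then show "id_mor A \<in> bd_hom A A"
    by (simp add: id_mor_def pre_class_in_hom id_pre_in)
next
  fix A B X
  assume "A \<in> BD" "B \<in> BD" and X: "X \<in> bd_hom A B"
  moreover obtain f where "f \<in> premorphisms A B" "X = pre_class A B f"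
    by (rule bd_hom_cases[OF X])
  ultimately show "comp_mor A A B X (id_mor A) = X" "comp_mor A B B (id_mor B) X = X"
    by (simp_all add: id_mor_def comp_mor_pre_class id_pre_in comp_pre_id_right comp_pre_id_left)
qed

text \<open>The second conjunct records that \<open>comp_mor\<close>, defined as a union over
  representatives, is the composition of classes given by \<open>[g][f] = [gf]\<close>.\<close>

theorem theorem2p7:
  shows "category BD bd_hom comp_mor id_mor \<and>
    (\<forall>B\<in>BD. \<forall>C\<in>BD. \<forall>D\<in>BD. \<forall>f\<in>premorphisms B C. \<forall>g\<in>premorphisms C D.
       comp_mor B C D (pre_class C D g) (pre_class B C f) = pre_class B D (comp_pre B D g f))"
  using category_BD comp_mor_pre_class by blast

end
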